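(* Let $G$ be a connected simple graph with vertices $v_1,\dots,v_n$ and edges $e_1,\dots,e_m$, $\mu$ a metric on $G$, $Q=(q_{ij})$ a task matrix, and $v\in V(G)$. Form the doubling $\hat G$, metric $\hat\mu$, orientation $\hat{\mathfrak{o}}$, lift $\alpha\in C_1(\hat G,\mathbb{Z})$ of $Q$, and vertex $\hat v$ of $\hat G$ over $v$, as in the context. Define $\beta\in H_1(\hat G,\mathbb{Z})$ as follows: (a) if $\hat v$ is a vertex of $\mathrm{supp}(\alpha)$, let $\beta$ be an element of $\Lambda_{\hat G}(\alpha)\cap H_1(\hat G,\mathbb{Z})$ minimizing $\Vert\cdot\Vert_{\hat\mu}$; (b) otherwise, let $\hat{\mathbf{e}}_1,\dots,\hat{\mathbf{e}}_s$ be the oriented edges in $\mathbf{E}_{\hat{\mathfrak{o}}}(\hat G)$ with initial vertex $\hat v$, put $\alpha_i=\alpha+\hat{\mathbf{e}}_i$, let $\beta_i$ be an element of $\Lambda_{\hat G}(\alpha_i)\cap H_1(\hat G,\mathbb{Z})$ minimizing $\Vert\cdot\Vert_{\hat\mu}$, and let $\beta$ be one of $\beta_1,\dots,\beta_s$ with $\Vert\beta\Vert_{\hat\mu}=\min_i\Vert\beta_i\Vert_{\hat\mu}$. If $\beta$ is connected, then the minimum $\mu$-length of a feasible closed walk for the one-carrier transportation routing problem $(G,\mu,Q,v)$ equals $\Vert\beta\Vert_{\hat\mu}$; moreover there is a circuit $\hat C$ on $\hat G$ starting at $\hat v$ with $\hat C^{\mathrm{ab}}=\beta$ and length $\Vert\beta\Vert$,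 and for any such $\hat C$ the projection $\pi(\hat C)$ is an optimal (shortest feasible) closed walk on $G$ starting at $v$.
   Context: Graphs: each edge $e$ gives two oriented edges $\mathbf{e},\mathbf{e}^{-1}$ with initial/terminal vertices $\mathbf{e}(0),\mathbf{e}(1)$. A walk is $\mathbf{a}_1\cdots\mathbf{a}_l$ with $\mathbf{a}_{i+1}(0)=\mathbf{a}_i(1)$; closed if $\mathbf{a}_l(1)=\mathbf{a}_1(0)$; a circuit is a closed walk with no backtrack ($\mathbf{a}_{i+1}\ne\mathbf{a}_i^{-1}$) and no tail ($\mathbf{a}_1\ne\mathbf{a}_l^{-1}$). A metric is $\mu:E\to\mathbb{R}_{>0}$; the $\mu$-length of a walk is $\sum_i\mu(\mathbf{a}_i)$. For an orientation $\mathfrak{o}$ with chosen oriented edges $\mathbf{E}_{\mathfrak{o}}$, $C_1(\cdot,\mathbb{Z})$ is the free abelian group on $\mathbf{E}_{\mathfrak{o}}$ with $\mathbf{e}^{-1}=-\mathbf{e}$; for $\alpha=\sum c_{\mathbf{e}}\mathbf{e}$, $\deg_\alpha(\mathbf{e})=c_{\mathbf{e}}$, $\deg_\alpha(\mathbf{e}^{-1})=-c_{\mathbf{e}}$, $\deg_\alpha(u)=\sum_{\mathbf{e}(0)=u}\deg_\alpha(\mathbf{e})$ over all oriented edges; $H_1=\{\alpha:\deg_\alpha(u)=0\ \forall u\}$; $\Vert\alpha\Vert_\mu=\sum|c_{\mathbf{e}}|\mu(\mathbf{e})$ and $\Vert\alpha\Vert$ is this with $\mu\equiv1$. The abelianization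 $\hat C^{\mathrm{ab}}$ of a walk is the sum of its oriented edges. A partial orientation is an orientation of a subgraph without isolated vertices (its support); a nonzero $\alpha$ is uniquely $\sum c_{\mathbf{e}}\mathbf{e}$ with $c_{\mathbf{e}}>0$ over oriented edges with distinct underlying edges, these oriented edges form the partial orientation $\mathfrak{o}(\alpha)$, whose support is $\mathrm{supp}(\alpha)$ ($\mathfrak{o}(0)$ is the empty partial orientation); $\alpha$ is connected if $\mathrm{supp}(\alpha)$ is connected. Partial orders: $\mathfrak{o}\le\mathfrak{o}'$ if $\mathrm{supp}(\mathfrak{o})\subseteq\mathrm{supp}(\mathfrak{o}')$ and $\mathfrak{o}'$ restricts to $\mathfrak{o}$ there; $\alpha\le_{\mathfrak{o}}\beta$ if $\mathrm{supp}(\beta-\alpha)\subseteq\mathrm{supp}(\mathfrak{o})$ and $\beta-\alpha=\sum c_{\mathbf{e}}\mathbf{e}$ over oriented edges of $\mathfrak{o}$ with all $c_{\mathbf{e}}\ge0$; $\alpha\le\beta$ if $\mathfrak{o}(\alpha)\le\mathfrak{o}(\beta)$ and $\alpha\le_{\mathfrak{o}(\beta)}\beta$; $\Lambda_{\hat G}(\alpha)=\{\beta\in C_1(\hat G,\mathbb{Z}):\alpha\le\beta\}$. Problem: $Q=(q_{ij})_{n\times n}$ has nonnegative integer entries with $q_{ij}=0$ unless $v_i,v_j$ are adjacent. For a closed walk $C$ on $G$ (backtracks allowed), $\theta_{ij}(C)$ is the number of times $C$ traverses the oriented edge from $v_i$ to $v_j$. A feasible closed walk is a closed walk starting and ending at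 $v$ with $\theta_{ij}(C)\ge q_{ij}$ for all adjacent $v_i,v_j$; the problem is to find a feasible closed walk of minimum $\mu$-length. Doubling: $\hat G$ has vertices $\hat v_1,\dots,\hat v_n$ and, for each edge $e_k=v_iv_j$, two parallel edges $\hat e_{k,1},\hat e_{k,2}$ between $\hat v_i,\hat v_j$ with $\hat\mu(\hat e_{k,1})=\hat\mu(\hat e_{k,2})=\mu(e_k)$; $\pi:\hat G\to G$ sends $\hat v_i\mapsto v_i$, $\hat e_{k,1},\hat e_{k,2}\mapsto e_k$, and maps walks to walks; $\hat v=\pi^{-1}(v)$. $\hat{\mathfrak{o}}$ is an orientation of $\hat G$ orienting $\hat e_{k,1}$ and $\hat e_{k,2}$ oppositely for each $k$; the lift of $Q$ is $\alpha=\sum_{k}(q_{ij}\hat{\mathbf{e}}_{k,1}+q_{ji}\hat{\mathbf{e}}_{k,2})$, where $\hat{\mathbf{e}}_{k,1}$ is the $\hat{\mathfrak{o}}$-orientation of $\hat e_{k,1}$, going from $\hat v_i$ to $\hat v_j$, and $\hat{\mathbf{e}}_{k,2}$ that of $\hat e_{k,2}$, going from $\hat v_j$ to $\hat v_i$. *)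

theory Defs
  imports
    Complex_Main
    "HOL-Library.Poly_Mapping"
    "Graph_Theory.Digraph_Component"
begin

text \<open>
  A graph is given by its oriented edges: a \<^typ>\<open>('v, 'a) pre_digraph\<close> \<open>G\<close> whose arcs are the
  oriented edges \<open>a\<close>, with \<open>a(0) = tail G a\<close> and \<open>a(1) = head G a\<close>, together with the inversion
  \<open>rv\<close> mapping \<open>a\<close> to its inverse (locale \<^locale>\<open>bidirected_digraph\<close>).  The underlying
  unoriented edge of \<open>a\<close> is the two-element set \<open>{a, rv a}\<close>.
\<close>

definition edges :: "('v, 'a) pre_digraph \<Rightarrow> ('a \<Rightarrow> 'a) \<Rightarrow> 'a set set" where
  "edges G rv = (\<lambda>a. {a, rv a}) ` arcs G"

definition metric :: "('v, 'a) pre_digraph \<Rightarrow> ('a \<Rightarrow> 'a) \<Rightarrow> ('a set \<Rightarrow> real) \<Rightarrow> bool" where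
  "metric G rv \<mu> \<longleftrightarrow> (\<forall>e \<in> edges G rv. \<mu> e > 0)"

text \<open>
  Walks consist of at least one oriented edge, so that a first and a last edge exist;
  \<^const>\<open>pre_digraph.awalk\<close> alone would admit the empty walk.
\<close>

definition closed_walk_at :: "('v, 'a) pre_digraph \<Rightarrow> 'v \<Rightarrow> 'a list \<Rightarrow> bool" where
  "closed_walk_at G v p \<longleftrightarrow> p \<noteq> [] \<and> pre_digraph.awalk G v p v"

definition circuit_at :: "('v, 'a) pre_digraph \<Rightarrow> ('a \<Rightarrow> 'a) \<Rightarrow> 'v \<Rightarrow> 'a list \<Rightarrow> bool" where
  "circuit_at G rv v p \<longleftrightarrow> closed_walk_at G v p
     \<and> (\<forall>i. Suc i < length p \<longrightarrow> p ! Suc i \<noteq> rv (p ! i)) \<and> hd p \<noteq> rv (last p)"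

definition walk_length :: "('a \<Rightarrow> 'a) \<Rightarrow> ('a set \<Rightarrow> real) \<Rightarrow> 'a list \<Rightarrow> real" where
  "walk_length rv \<mu> p = (\<Sum>a\<leftarrow>p. \<mu> {a, rv a})"


definition orientation :: "('v, 'a) pre_digraph \<Rightarrow> ('a \<Rightarrow> 'a) \<Rightarrow> 'a set \<Rightarrow> bool" where
  "orientation G rv ori \<longleftrightarrow> ori \<subseteq> arcs G \<and> (\<forall>a \<in> arcs G. a \<in> ori \<longleftrightarrow> rv a \<notin> ori)"

text \<open>
  A partial orientation is represented by its set \<open>P\<close> of oriented edges; since its support has no
  isolated vertices, the support is determined by \<open>P\<close>.
\<close>

definition support :: "('v, 'a) pre_digraph \<Rightarrow> ('a \<Rightarrow> 'a) \<Rightarrow> 'a set \<Rightarrow> ('v, 'a) pre_digraph" where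
  "support G rv P =
     \<lparr> verts = tail G ` P \<union> head G ` P, arcs = P \<union> rv ` P, tail = tail G, head = head G \<rparr>"

definition orientation_le ::
  "('v, 'a) pre_digraph \<Rightarrow> ('a \<Rightarrow> 'a) \<Rightarrow> 'a set \<Rightarrow> 'a set \<Rightarrow> bool" where
  "orientation_le G rv P P' \<longleftrightarrow>
     subgraph (support G rv P) (support G rv P') \<and> P' \<inter> arcs (support G rv P) = P"


text \<open>
  \<open>C\<^sub>1(G, \<int>)\<close> is the free abelian group on the oriented edges in an orientation \<open>ori\<close>, i.e. the
  carrier of \<open>free_Abelian_group ori\<close>; it lives in the type \<^typ>\<open>'a \<Rightarrow>\<^sub>0 int\<close>.  An oriented edge
  outside \<open>ori\<close> stands for minus its inverse.
\<close>

definition chains :: "'a set \<Rightarrow> ('a \<Rightarrow>\<^sub>0 int) set" where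
  "chains ori = {\<alpha>. Poly_Mapping.keys \<alpha> \<subseteq> ori}"

definition edge_chain :: "('a \<Rightarrow> 'a) \<Rightarrow> 'a set \<Rightarrow> 'a \<Rightarrow> ('a \<Rightarrow>\<^sub>0 int)" where
  "edge_chain rv ori a = (if a \<in> ori then frag_of a else - frag_of (rv a))"

definition deg_edge :: "('a \<Rightarrow> 'a) \<Rightarrow> 'a set \<Rightarrow> ('a \<Rightarrow>\<^sub>0 int) \<Rightarrow> 'a \<Rightarrow> int" where
  "deg_edge rv ori \<alpha> a =
     (if a \<in> ori then Poly_Mapping.lookup \<alpha> a else - Poly_Mapping.lookup \<alpha> (rv a))"

definition deg_vertex ::
  "('v, 'a) pre_digraph \<Rightarrow> ('a \<Rightarrow> 'a) \<Rightarrow> 'a set \<Rightarrow> ('a \<Rightarrow>\<^sub>0 int) \<Rightarrow> 'v \<Rightarrow> int" where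
  "deg_vertex G rv ori \<alpha> u = (\<Sum>a \<in> out_arcs G u. deg_edge rv ori \<alpha> a)"

definition homology1 ::
  "('v, 'a) pre_digraph \<Rightarrow> ('a \<Rightarrow> 'a) \<Rightarrow> 'a set \<Rightarrow> ('a \<Rightarrow>\<^sub>0 int) set" where
  "homology1 G rv ori = {\<alpha> \<in> chains ori. \<forall>u \<in> verts G. deg_vertex G rv ori \<alpha> u = 0}"

definition chain_norm ::
  "('a \<Rightarrow> 'a) \<Rightarrow> 'a set \<Rightarrow> ('a set \<Rightarrow> real) \<Rightarrow> ('a \<Rightarrow>\<^sub>0 int) \<Rightarrow> real" where
  "chain_norm rv ori \<mu> \<alpha> =
     (\<Sum>a \<in> ori. real_of_int \<bar>Poly_Mapping.lookup \<alpha> a\<bar> * \<mu> {a, rv a})"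

definition abelianization :: "('a \<Rightarrow> 'a) \<Rightarrow> 'a set \<Rightarrow> 'a list \<Rightarrow> ('a \<Rightarrow>\<^sub>0 int)" where
  "abelianization rv ori p = (\<Sum>a\<leftarrow>p. edge_chain rv ori a)"

text \<open>
  In the unique expression of \<open>\<alpha>\<close> with positive coefficients over oriented edges with distinct
  underlying edges, the oriented edges that occur are those of positive degree, the degree being
  the coefficient.
\<close>

definition chain_orientation ::
  "('v, 'a) pre_digraph \<Rightarrow> ('a \<Rightarrow> 'a) \<Rightarrow> 'a set \<Rightarrow> ('a \<Rightarrow>\<^sub>0 int) \<Rightarrow> 'a set" where
  "chain_orientation G rv ori \<alpha> = {a \<in> arcs G. deg_edge rv ori \<alpha> a > 0}"

definition chain_support ::
  "('v, 'a) pre_digraph \<Rightarrow> ('a \<Rightarrow> 'a) \<Rightarrow> 'a set \<Rightarrow> ('a \<Rightarrow>\<^sub>0 int) \<Rightarrow> ('v, 'a) pre_digraph" where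
  "chain_support G rv ori \<alpha> = support G rv (chain_orientation G rv ori \<alpha>)"

definition connected_chain ::
  "('v, 'a) pre_digraph \<Rightarrow> ('a \<Rightarrow> 'a) \<Rightarrow> 'a set \<Rightarrow> ('a \<Rightarrow>\<^sub>0 int) \<Rightarrow> bool" where
  "connected_chain G rv ori \<alpha> \<longleftrightarrow> Digraph_Component.connected (chain_support G rv ori \<alpha>)"

definition chain_le_along ::
  "('v, 'a) pre_digraph \<Rightarrow> ('a \<Rightarrow> 'a) \<Rightarrow> 'a set \<Rightarrow> 'a set \<Rightarrow> ('a \<Rightarrow>\<^sub>0 int) \<Rightarrow> ('a \<Rightarrow>\<^sub>0 int) \<Rightarrow> bool" where
  "chain_le_along G rv ori P \<alpha> \<beta> \<longleftrightarrow>
     subgraph (chain_support G rv ori (\<beta> - \<alpha>)) (support G rv P) \<and>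
     (\<exists>c :: 'a \<Rightarrow> int. (\<forall>a \<in> P. c a \<ge> 0) \<and>
        \<beta> - \<alpha> = (\<Sum>a \<in> P. frag_cmul (c a) (edge_chain rv ori a)))"

definition chain_le ::
  "('v, 'a) pre_digraph \<Rightarrow> ('a \<Rightarrow> 'a) \<Rightarrow> 'a set \<Rightarrow> ('a \<Rightarrow>\<^sub>0 int) \<Rightarrow> ('a \<Rightarrow>\<^sub>0 int) \<Rightarrow> bool" where
  "chain_le G rv ori \<alpha> \<beta> \<longleftrightarrow>
     orientation_le G rv (chain_orientation G rv ori \<alpha>) (chain_orientation G rv ori \<beta>) \<and>
     chain_le_along G rv ori (chain_orientation G rv ori \<beta>) \<alpha> \<beta>"

definition Lambda ::
  "('v, 'a) pre_digraph \<Rightarrow> ('a \<Rightarrow> 'a) \<Rightarrow> 'a set \<Rightarrow> ('a \<Rightarrow>\<^sub>0 int) \<Rightarrow> ('a \<Rightarrow>\<^sub>0 int) set" where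
  "Lambda G rv ori \<alpha> = {\<beta> \<in> chains ori. chain_le G rv ori \<alpha> \<beta>}"

definition minimal_cycle_above ::
  "('v, 'a) pre_digraph \<Rightarrow> ('a \<Rightarrow> 'a) \<Rightarrow> 'a set \<Rightarrow> ('a set \<Rightarrow> real) \<Rightarrow>
     ('a \<Rightarrow>\<^sub>0 int) \<Rightarrow> ('a \<Rightarrow>\<^sub>0 int) \<Rightarrow> bool" where
  "minimal_cycle_above G rv ori \<mu> \<alpha> \<beta> \<longleftrightarrow>
     is_arg_min (chain_norm rv ori \<mu>) (\<lambda>\<gamma>. \<gamma> \<in> Lambda G rv ori \<alpha> \<inter> homology1 G rv ori) \<beta>"


text \<open>
  Finite simple graphs are those of the locale \<^locale>\<open>pair_graph\<close>: the oriented edge from \<open>u\<close> to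
  \<open>w\<close> is the pair \<open>(u, w)\<close>, and inversion is \<open>swap_in (parcs G)\<close>.
\<close>

definition task_matrix :: "'v pair_pre_digraph \<Rightarrow> ('v \<Rightarrow> 'v \<Rightarrow> nat) \<Rightarrow> bool" where
  "task_matrix G Q \<longleftrightarrow> (\<forall>u \<in> pverts G. \<forall>w \<in> pverts G. (u, w) \<notin> parcs G \<longrightarrow> Q u w = 0)"

definition feasible_walk ::
  "'v pair_pre_digraph \<Rightarrow> ('v \<Rightarrow> 'v \<Rightarrow> nat) \<Rightarrow> 'v \<Rightarrow> ('v \<times> 'v) list \<Rightarrow> bool" where
  "feasible_walk G Q v C \<longleftrightarrow> closed_walk_at (with_proj G) v C
     \<and> (\<forall>(u, w) \<in> parcs G. count_list C (u, w) \<ge> Q u w)"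

definition optimal_walk ::
  "'v pair_pre_digraph \<Rightarrow> (('v \<times> 'v) set \<Rightarrow> real) \<Rightarrow> ('v \<Rightarrow> 'v \<Rightarrow> nat) \<Rightarrow> 'v \<Rightarrow> ('v \<times> 'v) list \<Rightarrow> bool"
  where
  "optimal_walk G \<mu> Q v C \<longleftrightarrow>
     is_arg_min (walk_length (swap_in (parcs G)) \<mu>) (feasible_walk G Q v) C"

text \<open>
  The doubling: \<open>(a, First)\<close> and \<open>(a, Second)\<close> are the two oriented edges over \<open>a\<close>.  The vertex
  over \<open>v\<close> is \<open>v\<close> itself, and the projection is \<^const>\<open>fst\<close> on oriented edges.
\<close>

datatype copy = First | Second

definition doubling :: "'v pair_pre_digraph \<Rightarrow> ('v, ('v \<times> 'v) \<times> copy) pre_digraph" where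
  "doubling G = \<lparr> verts = pverts G, arcs = parcs G \<times> UNIV,
     tail = (\<lambda>(a, i). fst a), head = (\<lambda>(a, i). snd a) \<rparr>"

definition doubling_rev ::
  "'v pair_pre_digraph \<Rightarrow> ('v \<times> 'v) \<times> copy \<Rightarrow> ('v \<times> 'v) \<times> copy" where
  "doubling_rev G = map_prod (swap_in (parcs G)) id"

lemma (in pair_graph) bidirected_digraph_doubling:
  "bidirected_digraph (doubling G) (doubling_rev G)"
proof (rule wf_digraph.bidirected_digraphI)
  have sym: "(w, u) \<in> parcs G" if "(u, w) \<in> parcs G" for u w
    using pair_sym_arcs that by (simp add: symmetric_def symD)
  have irrefl: "u \<noteq> w" if "(u, w) \<in> parcs G" for u w
    using pair_no_loops[OF that] by simp
  show "wf_digraph (doubling G)"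
    by (rule wf_digraph.intro) (auto simp: doubling_def dest: in_arcsD1 in_arcsD2)
  show "doubling_rev G a = a" if "a \<notin> arcs (doubling G)" for a
    using that by (cases a) (simp add: doubling_def doubling_rev_def swap_in_def)
  show "doubling_rev G a \<noteq> a" if "a \<in> arcs (doubling G)" for a
    using that irrefl
    by (cases a; cases "fst a") (auto simp: doubling_def doubling_rev_def swap_in_def)
  show "doubling_rev G (doubling_rev G a) = a" if "a \<in> arcs (doubling G)" for a
    using that sym
    by (cases a; cases "fst a") (auto simp: doubling_def doubling_rev_def swap_in_def)
  show "tail (doubling G) (doubling_rev G a) = head (doubling G) a" if "a \<in> arcs (doubling G)" for a
    using that by (cases a; cases "fst a") (auto simp: doubling_def doubling_rev_def swap_in_def)
qed

definition doubling_metric ::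
  "(('v \<times> 'v) set \<Rightarrow> real) \<Rightarrow> (('v \<times> 'v) \<times> copy) set \<Rightarrow> real" where
  "doubling_metric \<mu> e = \<mu> (fst ` e)"

definition proj_walk :: "(('v \<times> 'v) \<times> copy) list \<Rightarrow> ('v \<times> 'v) list" where
  "proj_walk = map fst"

definition doubling_orientation :: "'v pair_pre_digraph \<Rightarrow> (('v \<times> 'v) \<times> copy) set \<Rightarrow> bool" where
  "doubling_orientation G ori \<longleftrightarrow> orientation (doubling G) (doubling_rev G) ori \<and>
     (\<forall>(u, w) \<in> parcs G. ((u, w), First) \<in> ori \<longleftrightarrow> ((w, u), Second) \<in> ori)"

text \<open>
  The index set below contains exactly one of \<open>(u, w)\<close>, \<open>(w, u)\<close> for each edge \<open>uw\<close> of \<open>G\<close>, namely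
  the direction in which \<open>ori\<close> orients its first copy; the sum is over the edges of \<open>G\<close>.
\<close>

definition task_lift ::
  "('v \<Rightarrow> 'v \<Rightarrow> nat) \<Rightarrow> (('v \<times> 'v) \<times> copy) set \<Rightarrow> (('v \<times> 'v) \<times> copy) \<Rightarrow>\<^sub>0 int" where
  "task_lift Q ori = (\<Sum>(u, w) \<in> {a. (a, First) \<in> ori}.
     frag_cmul (int (Q u w)) (frag_of ((u, w), First)) +
     frag_cmul (int (Q w u)) (frag_of ((w, u), Second)))"

end

theory Submission
  imports Defs "Graph_Theory.Euler"
begin

text \<open>
  A walk \<open>C\<close> on \<open>G\<close> lifts to the doubling so that only edges oriented by \<open>ori\<close> are used; its
  abelianization is then a cycle above the lift of the task matrix whose norm is the length of
  \<open>C\<close>, so \<open>\<beta>\<close> bounds the optimum from below.  When \<open>v\<close> meets no task, the first edge of \<open>C\<close>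
  supplies the extra edge of case (b).  Conversely a connected cycle is an Eulerian multigraph; an
  Euler tour traverses each oriented edge as often as its positive degree, so it is a circuit whose
  projection is feasible and has length the norm of \<open>\<beta>\<close>.
\<close>

section \<open>Chains and walks on an oriented graph\<close>

lemma in_chains_iff: "\<alpha> \<in> chains ori \<longleftrightarrow> (\<forall>a. a \<notin> ori \<longrightarrow> Poly_Mapping.lookup \<alpha> a = 0)"
  by (auto simp: chains_def in_keys_iff)

lemma deg_edge_add: "deg_edge rv ori (\<alpha> + \<beta>) a = deg_edge rv ori \<alpha> a + deg_edge rv ori \<beta> a"
  by (simp add: deg_edge_def lookup_add)

lemma deg_edge_diff: "deg_edge rv ori (\<alpha> - \<beta>) a = deg_edge rv ori \<alpha> a - deg_edge rv ori \<beta> a"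
  by (simp add: deg_edge_def lookup_minus)

lemma deg_edge_zero: "deg_edge rv ori 0 a = 0"
  by (simp add: deg_edge_def)

lemma deg_edge_sum: "deg_edge rv ori (sum f S) a = (\<Sum>x \<in> S. deg_edge rv ori (f x) a)"
  by (induction S rule: infinite_finite_induct) (simp_all add: deg_edge_zero deg_edge_add)

lemma deg_edge_cmul: "deg_edge rv ori (frag_cmul c \<alpha>) a = c * deg_edge rv ori \<alpha> a"
  by (simp add: deg_edge_def)

lemma sum_list_map_eq_sum_count_real:
  fixes f :: "'a \<Rightarrow> real"
  assumes "set p \<subseteq> A" and "finite A"
  shows "(\<Sum>x\<leftarrow>p. f x) = (\<Sum>x \<in> A. real (count_list p x) * f x)"
  using assms(1)
proof (induction p)
  case (Cons y p)
  have "(\<Sum>x \<in> A. real (count_list (y # p) x) * f x) =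
      (\<Sum>x \<in> A. (if x = y then f x else 0) + real (count_list p x) * f x)"
    by (rule sum.cong) (auto simp: algebra_simps)
  also have "\<dots> = f y + (\<Sum>x \<in> A. real (count_list p x) * f x)"
    using Cons.prems assms(2) by (simp add: sum.distrib)
  finally show ?case
    using Cons by simp
qed simp

locale oriented_graph = bidirected_digraph G rv + fin_digraph G
  for G :: "('v, 'a) pre_digraph" and rv :: "'a \<Rightarrow> 'a" +
  fixes ori :: "'a set"
  assumes orientation: "orientation G rv ori"
begin

lemma ori_subset: "ori \<subseteq> arcs G"
  and rv_in_ori_iff: "a \<in> arcs G \<Longrightarrow> rv a \<in> ori \<longleftrightarrow> a \<notin> ori"
  using orientation unfolding orientation_def by blast+

lemma finite_ori: "finite ori"
  using ori_subset finite_arcs by (rule finite_subset)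

text \<open>Each edge has exactly one of its two directions in \<open>ori\<close>, so
  \<open>ori\<close> and its image under \<open>rv\<close> partition the arcs. This is the bridge
  between chain norms, summed over \<open>ori\<close>, and walk lengths, summed over all
  arcs.\<close>

lemma sum_arcs: "(\<Sum>a \<in> arcs G. f a) = (\<Sum>a \<in> ori. f a + f (rv a))"
  for f :: "'a \<Rightarrow> 'c :: comm_monoid_add"
proof -
  have "arcs G = ori \<union> rv ` ori"
  proof
    show "arcs G \<subseteq> ori \<union> rv ` ori"
    proof
      fix a assume "a \<in> arcs G"
      then show "a \<in> ori \<union> rv ` ori"
        using rv_in_ori_iff[of a] by (cases "a \<in> ori") (auto intro: image_eqI[of _ _ "rv a"])
    qed
  qed (use ori_subset in auto)
  moreover have "ori \<inter> rv ` ori = {}"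
    using ori_subset rv_in_ori_iff by auto
  ultimately have "(\<Sum>a \<in> arcs G. f a) = (\<Sum>a \<in> ori. f a) + (\<Sum>a \<in> rv ` ori. f a)"
    using finite_ori by (simp add: sum.union_disjoint)
  then show ?thesis
    by (simp add: sum.distrib sum.reindex inj_on_arev)
qed

abbreviation deg :: "('a \<Rightarrow>\<^sub>0 int) \<Rightarrow> 'a \<Rightarrow> int" where
  "deg \<equiv> deg_edge rv ori"

lemma deg_ori: "a \<in> ori \<Longrightarrow> deg \<alpha> a = Poly_Mapping.lookup \<alpha> a"
  by (simp add: deg_edge_def)

lemma deg_rv: "a \<in> arcs G \<Longrightarrow> deg \<alpha> (rv a) = - deg \<alpha> a"
  by (simp add: deg_edge_def rv_in_ori_iff)

lemma chain_eqI:
  assumes "\<alpha> \<in> chains ori" "\<beta> \<in> chains ori" and "\<And>a. a \<in> ori \<Longrightarrow> deg \<alpha> a = deg \<beta> a"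
  shows "\<alpha> = \<beta>"
proof (rule poly_mapping_eqI)
  show "Poly_Mapping.lookup \<alpha> a = Poly_Mapping.lookup \<beta> a" for a
    using assms by (cases "a \<in> ori") (auto simp: in_chains_iff deg_ori)
qed

lemma deg_edge_chain:
  assumes "a \<in> arcs G" "b \<in> arcs G"
  shows "deg (edge_chain rv ori b) a = (if b = a then 1 else 0) - (if b = rv a then 1 else 0)"
proof -
  have "rv b = a \<longleftrightarrow> b = rv a" "rv b = rv a \<longleftrightarrow> b = a"
    using arev_arev by metis+
  then show ?thesis
    using rv_in_ori_iff[OF assms(1)] rv_in_ori_iff[OF assms(2)] arev_neq[OF assms(1)]
    by (cases "a \<in> ori"; cases "b \<in> ori") (auto simp: deg_edge_def edge_chain_def)
qed

lemma deg_abelianization: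
  assumes "set p \<subseteq> arcs G" "a \<in> arcs G"
  shows "deg (abelianization rv ori p) a = int (count_list p a) - int (count_list p (rv a))"
  using assms(1)
  by (induction p) (auto simp: abelianization_def deg_edge_zero deg_edge_add deg_edge_chain assms(2))

lemma abelianization_in_chains:
  assumes "set p \<subseteq> arcs G"
  shows "abelianization rv ori p \<in> chains ori"
  using assms
  by (induction p) (auto simp: in_chains_iff abelianization_def lookup_add edge_chain_def rv_in_ori_iff)

text \<open>Inverse arcs have opposite degrees, so of the two truncations by \<open>nat\<close> one
  is the absolute value and the other is 0. The norm thereby takes the form of
  \<open>walk_length_conv\<close>, with positive degrees in place of counts.\<close>

lemma chain_norm_conv:
  "chain_norm rv ori \<mu> \<alpha> = (\<Sum>a \<in> arcs G. real (nat (deg \<alpha> a)) * \<mu> {a, rv a})"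
proof -
  have "real_of_int \<bar>Poly_Mapping.lookup \<alpha> a\<bar> * \<mu> {a, rv a} =
      real (nat (deg \<alpha> a)) * \<mu> {a, rv a} + real (nat (deg \<alpha> (rv a))) * \<mu> {rv a, rv (rv a)}"
    if "a \<in> ori" for a
    using that ori_subset by (subst deg_rv) (auto simp: deg_ori insert_commute abs_if)
  then show ?thesis
    by (simp add: sum_arcs chain_norm_def)
qed

lemma walk_length_conv:
  assumes "set p \<subseteq> arcs G"
  shows "walk_length rv \<mu> p = (\<Sum>a \<in> arcs G. real (count_list p a) * \<mu> {a, rv a})"
  using assms finite_arcs unfolding walk_length_def by (rule sum_list_map_eq_sum_count_real)

lemma walk_length_one: "walk_length rv (\<lambda>_. 1) p = real (length p)"
  by (induction p) (simp_all add: walk_length_def)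

section \<open>Closed walks realizing a cycle\<close>

text \<open>A telescoping sum: every arc contributes +1 at its tail and -1 at its head, and interior
  contributions cancel.\<close>

lemma walk_boundary:
  assumes "awalk u p w" "x \<in> verts G"
  shows "(\<Sum>a \<in> out_arcs G x. int (count_list p a)) - (\<Sum>a \<in> in_arcs G x. int (count_list p a)) =
    (if u = x then 1 else 0) - (if w = x then 1 else 0)"
  using assms(1)
proof (induction p arbitrary: u)
  case Nil
  then show ?case by (auto simp: awalk_Nil_iff)
next
  case (Cons a p)
  then have a: "a \<in> arcs G" "u = tail G a" and p: "awalk (head G a) p w"
    by (auto simp: awalk_Cons_iff)
  have count: "int (count_list (a # p) b) = (if b = a then 1 else 0) + int (count_list p b)" for b
    by simp
  show ?case
    using Cons.IH[OF p] a
    by (simp add: count sum.distrib finite_in_arcs finite_out_arcs del: count_list.simps)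
qed

text \<open>A degree is its positive part minus that of its negative, and inversion matches out-arcs
  with in-arcs. Vanishing vertex degrees thus say that taking each arc as often as its positive
  degree gives a balanced multigraph.\<close>

lemma deg_vertex_conv:
  "deg_vertex G rv ori \<alpha> u =
    (\<Sum>a \<in> out_arcs G u. int (nat (deg \<alpha> a))) - (\<Sum>a \<in> in_arcs G u. int (nat (deg \<alpha> a)))"
proof -
  have "(\<Sum>a \<in> in_arcs G u. int (nat (deg \<alpha> a))) =
      (\<Sum>a \<in> out_arcs G u. int (nat (deg \<alpha> (rv a))))"
    by (simp add: in_arcs_eq sum.reindex inj_on_arev)
  then show ?thesis
    by (auto simp: deg_vertex_def deg_rv simp flip: sum_subtractf intro!: sum.cong)
qed

lemma abelianization_in_homology1:
  assumes "awalk u p u"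
  shows "abelianization rv ori p \<in> homology1 G rv ori"
proof -
  have p: "set p \<subseteq> arcs G"
    using assms by auto
  have "deg_vertex G rv ori (abelianization rv ori p) x = 0" if "x \<in> verts G" for x
  proof -
    have "deg_vertex G rv ori (abelianization rv ori p) x =
        (\<Sum>a \<in> out_arcs G x. int (count_list p a)) - (\<Sum>a \<in> out_arcs G x. int (count_list p (rv a)))"
      by (simp add: deg_vertex_def deg_abelianization[OF p] sum_subtractf)
    also have "\<dots> = 0"
      using walk_boundary[OF assms that] by (simp add: in_arcs_eq sum.reindex inj_on_arev)
    finally show ?thesis .
  qed
  then show ?thesis
    using abelianization_in_chains[OF p] by (simp add: homology1_def)
qed

text \<open>
  The multigraph with \<open>deg \<beta> a\<close> parallel copies of every \<open>a\<close> of positive degree is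
  connected and balanced, so it has an Euler tour.
\<close>

lemma exists_closed_walk_of_cycle:
  assumes \<beta>: "\<beta> \<in> homology1 G rv ori" and con: "connected_chain G rv ori \<beta>"
    and v: "v \<in> verts (chain_support G rv ori \<beta>)"
  obtains p where "closed_walk_at G v p" "\<And>a. a \<in> arcs G \<Longrightarrow> count_list p a = nat (deg \<beta> a)"
proof -
  define P where "P = chain_orientation G rv ori \<beta>"
  \<comment> \<open>The second component numbers the parallel copies. Only endpoints of
    \<open>P\<close> become vertices, since nothing beyond the support is known to be
    connected.\<close>
  define D :: "('v, 'a \<times> nat) pre_digraph" where
    "D = \<lparr> verts = tail G ` P \<union> head G ` P, arcs = Sigma P (\<lambda>a. {..<nat (deg \<beta> a)}),
      tail = tail G \<circ> fst, head = head G \<circ> fst \<rparr>"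
  have P: "P = {a \<in> arcs G. deg \<beta> a > 0}"
    by (simp add: P_def chain_orientation_def)
  then have finP: "finite P" by simp
  have D_arcs: "(a, k) \<in> arcs D \<longleftrightarrow> a \<in> arcs G \<and> k < nat (deg \<beta> a)" for a k
    by (auto simp: D_def P)
  have fst_D: "fst ` arcs D = P"
  proof (intro equalityI subsetI)
    fix a assume "a \<in> P"
    then show "a \<in> fst ` arcs D"
      by (intro image_eqI[of _ _ "(a, 0)"]) (auto simp: D_arcs P)
  qed (auto simp: D_arcs P)
  interpret D: fin_digraph D
    using finP by unfold_locales (auto simp: D_def)
  \<comment> \<open>Connectedness depends only on the vertices and the symmetrized pairs of
    endpoints, which change neither when inverse arcs are dropped nor when arcs are
    multiplied.\<close>
  have "mk_symmetric D = mk_symmetric (chain_support G rv ori \<beta>)"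
  proof -
    let ?ends = "\<lambda>a. {(tail G a, head G a), (head G a, tail G a)}"
    have "?ends (rv a) = ?ends a" if "a \<in> P" for a
      using that by (auto simp: P)
    then have "(\<Union>a \<in> P \<union> rv ` P. ?ends a) = (\<Union>a \<in> P. ?ends a)"
      by (simp add: UN_Un)
    also have "\<dots> = (\<Union>a \<in> fst ` arcs D. ?ends a)"
      by (simp add: fst_D)
    finally show ?thesis
      by (simp add: mk_symmetric_def D_def chain_support_def support_def P_def[symmetric])
  qed
  then have "connected D"
    using con by (simp add: connected_chain_def connected_def)
  moreover have "in_degree D u = out_degree D u" if "u \<in> verts D" for u
  proof -
    have "out_arcs D u = Sigma (out_arcs G u) (\<lambda>a. {..<nat (deg \<beta> a)})"
      "in_arcs D u = Sigma (in_arcs G u) (\<lambda>a. {..<nat (deg \<beta> a)})"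
      by (auto simp: D_arcs) (auto simp: D_def)
    then have "int (out_degree D u) = (\<Sum>a \<in> out_arcs G u. int (nat (deg \<beta> a)))"
      "int (in_degree D u) = (\<Sum>a \<in> in_arcs G u. int (nat (deg \<beta> a)))"
      by (auto simp: out_degree_def in_degree_def finite_in_arcs finite_out_arcs simp del: int_nat_eq)
    moreover have "u \<in> verts G"
      using that P by (auto simp: D_def)
    ultimately show ?thesis
      using \<beta> deg_vertex_conv[of \<beta> u] by (simp add: homology1_def)
  qed
  ultimately obtain u p where "D.euler_trail u p u"
    using D.closed_euler1 by blast
  then have p: "D.trail u p u" "set p = arcs D" "set (D.awalk_verts u p) = verts D"
    by (auto simp: D.euler_trail_def)
  have vD: "v \<in> verts D"
    using v by (simp add: D_def chain_support_def support_def P_def)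
  \<comment> \<open>The Euler tour starts at an unspecified \<open>u\<close> but visits every vertex
    of \<open>D\<close>, so it can be rotated to start at \<open>v\<close>.\<close>
  then obtain q where q: "D.trail v q v" "set q = arcs D"
    using D.rotate_trailE'[OF p(1)] p by metis
  have "verts D \<subseteq> verts G"
    using P by (auto simp: D_def)
  have "awalk x (map fst r) y" if "D.awalk x r y" for x y r
    using that
  proof (induction r arbitrary: x)
    case Nil
    then show ?case
      using \<open>verts D \<subseteq> verts G\<close> by (auto simp: D.awalk_Nil_iff awalk_Nil_iff)
  next
    case (Cons b r)
    then show ?case
      by (cases b) (auto simp: D.awalk_Cons_iff awalk_Cons_iff D_arcs, auto simp: D_def)
  qed
  then have "awalk v (map fst q) v"
    using q by (simp add: D.trail_def)
  moreover have "q \<noteq> []"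
    using vD q(2) fst_D by (auto simp: D_def)
  ultimately have "closed_walk_at G v (map fst q)"
    by (simp add: closed_walk_at_def)
  \<comment> \<open>A trail has distinct arcs, so \<open>a\<close> is traversed once for each of its
    copies.\<close>
  moreover have "count_list (map fst q) a = nat (deg \<beta> a)" if "a \<in> arcs G" for a
  proof -
    have "count_list (map fst q) a = length (filter (\<lambda>x. fst x = a) q)"
      by (simp add: count_list_eq_length_filter filter_map comp_def eq_commute)
    also have "\<dots> = card {x \<in> arcs D. fst x = a}"
      using q by (simp add: D.trail_def distinct_card[symmetric])
    also have "{x \<in> arcs D. fst x = a} = {a} \<times> {..<nat (deg \<beta> a)}"
      using that by (auto simp: D_arcs)
    finally show ?thesis by (simp add: card_cartesian_product)
  qed
  ultimately show ?thesis using that by blast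
qed

text \<open>Subtracting the positive part of \<open>- deg \<beta> a\<close> from that of
  \<open>deg \<beta> a\<close> recovers the degree.\<close>

lemma abelianization_eqI:
  assumes p: "set p \<subseteq> arcs G" and \<beta>: "\<beta> \<in> chains ori"
    and count: "\<And>a. a \<in> arcs G \<Longrightarrow> count_list p a = nat (deg \<beta> a)"
  shows "abelianization rv ori p = \<beta>"
proof (rule chain_eqI[OF abelianization_in_chains[OF p] \<beta>])
  fix a assume "a \<in> ori"
  then have "a \<in> arcs G" using ori_subset by auto
  then show "deg (abelianization rv ori p) a = deg \<beta> a"
    by (simp add: deg_abelianization[OF p] count deg_rv)
qed

text \<open>An oriented edge and its inverse cannot both have positive degree, so no backtrack arises.\<close>

lemma circuit_atI:
  assumes p: "closed_walk_at G v p"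
    and count: "\<And>a. a \<in> arcs G \<Longrightarrow> count_list p a = nat (deg \<beta> a)"
  shows "circuit_at G rv v p"
proof -
  have p': "p \<noteq> []" "set p \<subseteq> arcs G"
    using p by (auto simp: closed_walk_at_def)
  have "b \<noteq> rv a" if "a \<in> set p" "b \<in> set p" for a b
  proof
    assume "b = rv a"
    moreover have "deg \<beta> x > 0" if "x \<in> set p" for x
    proof -
      have "count_list p x \<noteq> 0"
        using that by (simp add: count_list_0_iff)
      then show ?thesis
        using that p' count[of x] by auto
    qed
    ultimately show False
      using that p' deg_rv[of a \<beta>] by (metis less_minus_iff minus_zero not_less_iff_gr_or_eq subsetD)
  qed
  then show ?thesis
    using p p'(1) by (auto simp: circuit_at_def)
qed

text \<open>
  For each \<open>a\<close>, the difference of the counts of \<open>a\<close> and \<open>rv a\<close> is the degree of \<open>a\<close>; the length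
  is minimal only if the smaller of the two counts vanishes everywhere.
\<close>

lemma count_of_tight_walk:
  assumes p: "set p \<subseteq> arcs G" and ab: "abelianization rv ori p = \<beta>"
    and len: "real (length p) = chain_norm rv ori (\<lambda>_. 1) \<beta>" and a: "a \<in> arcs G"
  shows "count_list p a = nat (deg \<beta> a)"
proof -
  have "real (\<Sum>a \<in> arcs G. nat (deg \<beta> a)) = real (\<Sum>a \<in> arcs G. count_list p a)"
    using len walk_length_conv[OF p, of "\<lambda>_. 1"] walk_length_one[of p]
      chain_norm_conv[of "\<lambda>_. 1" \<beta>] by simp
  then have eq: "(\<Sum>a \<in> arcs G. nat (deg \<beta> a)) = (\<Sum>a \<in> arcs G. count_list p a)"
    by (simp only: of_nat_eq_iff)
  have le: "nat (deg \<beta> a) \<le> count_list p a" if "a \<in> arcs G" for a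
    using deg_abelianization[OF p that] by (simp add: ab)
  show ?thesis
    using sum_mono_inv[OF eq le a finite_arcs] by simp
qed

section \<open>The order on chains\<close>

lemma Lambda_mono_orientation:
  assumes "\<beta> \<in> Lambda G rv ori \<alpha>"
  shows "chain_orientation G rv ori \<alpha> \<subseteq> chain_orientation G rv ori \<beta>"
  using assms by (auto simp: Lambda_def chain_le_def orientation_le_def)

text \<open>The difference of the chains is a nonnegative combination of arcs of \<open>P\<close>.
  Since \<open>a\<close> lies in \<open>P\<close> and its inverse does not, the degree of the
  difference at \<open>a\<close> is the single coefficient \<open>c a\<close>. This is how a cycle
  above \<alpha> inherits the tasks.\<close>

lemma Lambda_deg_le:
  assumes \<beta>: "\<beta> \<in> Lambda G rv ori \<alpha>" and a: "a \<in> arcs G" "deg \<alpha> a > 0"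
  shows "deg \<alpha> a \<le> deg \<beta> a"
proof -
  define P where "P = chain_orientation G rv ori \<beta>"
  have P: "P = {a \<in> arcs G. deg \<beta> a > 0}"
    by (simp add: P_def chain_orientation_def)
  have "finite P" by (simp add: P)
  have aP: "a \<in> P"
    using Lambda_mono_orientation[OF \<beta>] a by (auto simp: P_def chain_orientation_def)
  then have rva: "rv a \<notin> P"
    using a(1) by (auto simp: P deg_rv)
  obtain c where c: "\<forall>a \<in> P. c a \<ge> 0" "\<beta> - \<alpha> = (\<Sum>a \<in> P. frag_cmul (c a) (edge_chain rv ori a))"
    using \<beta> by (auto simp: Lambda_def chain_le_def chain_le_along_def P_def)
  have "deg (\<beta> - \<alpha>) a = (\<Sum>b \<in> P. c b * deg (edge_chain rv ori b) a)"
    by (simp add: c deg_edge_sum deg_edge_cmul)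
  also have "\<dots> = (\<Sum>b \<in> P. if b = a then c b else 0)"
    using a(1) rva by (intro sum.cong) (auto simp: P deg_edge_chain)
  also have "\<dots> = c a"
    using aP \<open>finite P\<close> by simp
  finally show ?thesis
    using bspec[OF c(1) aP] by (simp add: deg_edge_diff)
qed

lemma support_mono:
  assumes "P \<subseteq> P'" "P' \<subseteq> arcs G"
  shows "subgraph (support G rv P) (support G rv P')"
proof -
  have "wf_digraph (support G rv S)" if "S \<subseteq> arcs G" for S
    using that by unfold_locales (auto simp: support_def)
  then show ?thesis
    using assms by (auto simp: subgraph_def compatible_def) (auto simp: support_def)
qed

text \<open>An arc outside \<open>ori\<close> has the negated coefficient of its inverse as degree,
  which is never positive here.\<close>

lemma chain_orientation_nonneg:
  assumes "\<And>a. a \<in> ori \<Longrightarrow> Poly_Mapping.lookup \<gamma> a \<ge> 0"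
  shows "chain_orientation G rv ori \<gamma> = {a \<in> ori. Poly_Mapping.lookup \<gamma> a > 0}"
  using assms ori_subset rv_in_ori_iff
  by (force simp: chain_orientation_def deg_edge_def split: if_splits)

text \<open>Without negative coefficients all orientations involved lie inside \<open>ori\<close>,
  so they cannot conflict and the order reduces to comparing coefficients. It serves to place
  abelianizations of lifted walks above the task chain.\<close>

lemma Lambda_nonnegI:
  assumes \<alpha>: "\<alpha> \<in> chains ori" and \<gamma>: "\<gamma> \<in> chains ori"
    and le: "\<And>a. a \<in> ori \<Longrightarrow> 0 \<le> Poly_Mapping.lookup \<alpha> a"
      "\<And>a. a \<in> ori \<Longrightarrow> Poly_Mapping.lookup \<alpha> a \<le> Poly_Mapping.lookup \<gamma> a"
  shows "\<gamma> \<in> Lambda G rv ori \<alpha>"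
proof -
  define P where "P = chain_orientation G rv ori \<gamma>"
  have \<gamma>0: "0 \<le> Poly_Mapping.lookup \<gamma> a" if "a \<in> ori" for a
    using le that order_trans by blast
  have P: "P = {a \<in> ori. Poly_Mapping.lookup \<gamma> a > 0}"
    unfolding P_def using \<gamma>0 by (rule chain_orientation_nonneg)
  then have P_ori: "P \<subseteq> ori" "finite P"
    using finite_ori by auto
  have \<alpha>P: "chain_orientation G rv ori \<alpha> = {a \<in> ori. Poly_Mapping.lookup \<alpha> a > 0}"
    using le by (intro chain_orientation_nonneg)
  have diffP: "chain_orientation G rv ori (\<gamma> - \<alpha>) = {a \<in> ori. Poly_Mapping.lookup (\<gamma> - \<alpha>) a > 0}"
    using le by (intro chain_orientation_nonneg) (simp add: lookup_minus)
  have sub: "chain_orientation G rv ori \<alpha> \<subseteq> P" "chain_orientation G rv ori (\<gamma> - \<alpha>) \<subseteq> P"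
    using le by (force simp: \<alpha>P P, force simp: diffP P lookup_minus)
  have "orientation_le G rv (chain_orientation G rv ori \<alpha>) P"
    unfolding orientation_le_def
  proof
    show "subgraph (support G rv (chain_orientation G rv ori \<alpha>)) (support G rv P)"
      using sub(1) P_ori ori_subset by (intro support_mono) auto
    \<comment> \<open>The support also contains inverse arcs, but these lie outside
      \<open>ori\<close> and hence outside \<open>P\<close>.\<close>
    show "P \<inter> arcs (support G rv (chain_orientation G rv ori \<alpha>)) = chain_orientation G rv ori \<alpha>"
      using sub(1) P_ori ori_subset rv_in_ori_iff by (fastforce simp: support_def \<alpha>P)
  qed
  moreover have "chain_le_along G rv ori P \<alpha> \<gamma>"
    unfolding chain_le_along_def
  proof (intro conjI exI ballI)
    show "subgraph (chain_support G rv ori (\<gamma> - \<alpha>)) (support G rv P)"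
      unfolding chain_support_def using sub(2) P_ori ori_subset by (intro support_mono) auto
    \<comment> \<open>The coefficients of the difference itself serve as the witness
      \<open>c\<close>.\<close>
    show "0 \<le> Poly_Mapping.lookup (\<gamma> - \<alpha>) a" if "a \<in> P" for a
      using that le P_ori by (auto simp: lookup_minus)
    have "Poly_Mapping.lookup (\<Sum>a \<in> P. frag_cmul (Poly_Mapping.lookup (\<gamma> - \<alpha>) a) (edge_chain rv ori a)) b
        = Poly_Mapping.lookup (\<gamma> - \<alpha>) b" for b
    proof -
      have "(\<Sum>a \<in> P. Poly_Mapping.lookup (\<gamma> - \<alpha>) a * Poly_Mapping.lookup (edge_chain rv ori a) b) =
          (\<Sum>a \<in> P. if a = b then Poly_Mapping.lookup (\<gamma> - \<alpha>) a else 0)"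
        using P_ori by (intro sum.cong) (auto simp: edge_chain_def)
      also have "\<dots> = (if b \<in> P then Poly_Mapping.lookup (\<gamma> - \<alpha>) b else 0)"
        using P_ori by simp
      \<comment> \<open>Off \<open>P\<close> the difference vanishes: within \<open>ori\<close>
        because \<alpha> is squeezed between 0 and \<gamma>, outside because both are chains on
        \<open>ori\<close>.\<close>
      also have "\<dots> = Poly_Mapping.lookup (\<gamma> - \<alpha>) b"
      proof (cases "b \<in> ori")
        case True
        then show ?thesis
          using le[of b] by (auto simp: P lookup_minus)
      next
        case False
        then show ?thesis
          using \<alpha> \<gamma> P_ori by (auto simp: in_chains_iff lookup_minus)
      qed
      finally show ?thesis
        by (simp add: lookup_sum)
    qed
    then show "\<gamma> - \<alpha> = (\<Sum>a \<in> P. frag_cmul (Poly_Mapping.lookup (\<gamma> - \<alpha>) a) (edge_chain rv ori a))"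
      by (intro poly_mapping_eqI) simp
  qed
  ultimately show ?thesis
    using \<gamma> by (simp add: Lambda_def chain_le_def P_def)
qed

section \<open>Walks that stay inside the orientation\<close>

lemma lookup_abelianization_ori:
  assumes "set p \<subseteq> ori" "a \<in> ori"
  shows "Poly_Mapping.lookup (abelianization rv ori p) a = int (count_list p a)"
proof -
  \<comment> \<open>No inverse of a traversed arc occurs, so nothing cancels in the
    abelianization.\<close>
  have "rv a \<notin> set p"
    using assms ori_subset rv_in_ori_iff by blast
  then show ?thesis
    using deg_abelianization[of p a] assms ori_subset by (auto simp: deg_ori)
qed

lemma chain_norm_abelianization_ori:
  assumes "set p \<subseteq> ori"
  shows "chain_norm rv ori \<mu> (abelianization rv ori p) = walk_length rv \<mu> p"
  using assms sum_list_map_eq_sum_count_real[OF assms finite_ori, of "\<lambda>a. \<mu> {a, rv a}"]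
  by (simp add: chain_norm_def walk_length_def lookup_abelianization_ori)

text \<open>The abelianization of the walk is itself a competitor in the minimization, and its norm
  is the length of the walk.\<close>

lemma minimal_cycle_le_walk_length:
  assumes min: "minimal_cycle_above G rv ori \<mu> \<alpha> \<beta>"
    and \<alpha>: "\<alpha> \<in> chains ori" "\<And>a. a \<in> ori \<Longrightarrow> 0 \<le> Poly_Mapping.lookup \<alpha> a"
    and p: "awalk u p u" "set p \<subseteq> ori"
    and le: "\<And>a. a \<in> ori \<Longrightarrow> Poly_Mapping.lookup \<alpha> a \<le> int (count_list p a)"
  shows "chain_norm rv ori \<mu> \<beta> \<le> walk_length rv \<mu> p"
proof -
  have "abelianization rv ori p \<in> Lambda G rv ori \<alpha>"
    using \<alpha> p le ori_subset
    by (intro Lambda_nonnegI) (auto simp: lookup_abelianization_ori abelianization_in_chains)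
  then have "\<not> chain_norm rv ori \<mu> (abelianization rv ori p) < chain_norm rv ori \<mu> \<beta>"
    using min abelianization_in_homology1[OF p(1)]
    by (auto simp: minimal_cycle_above_def is_arg_min_def)
  then show ?thesis
    using p(2) by (simp add: chain_norm_abelianization_ori)
qed

end

section \<open>The doubling of a simple graph\<close>

locale doubled_graph = pair_graph G for G :: "'v pair_pre_digraph" +
  fixes ori :: "(('v \<times> 'v) \<times> copy) set"
  assumes doubling_orientation: "doubling_orientation G ori"

sublocale doubled_graph \<subseteq> Dbl: oriented_graph "doubling G" "doubling_rev G" ori
proof (intro oriented_graph.intro oriented_graph_axioms.intro)
  show bi: "bidirected_digraph (doubling G) (doubling_rev G)"
    by (rule bidirected_digraph_doubling)
  have "finite (UNIV :: copy set)"
    by (rule finite_subset[of _ "{First, Second}"]) (auto intro: copy.exhaust)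
  then show "fin_digraph (doubling G)"
    using bi pair_finite_verts pair_finite_arcs
    by (intro fin_digraph.intro fin_digraph_axioms.intro)
      (auto simp: bidirected_digraph_def doubling_def intro: finite_cartesian_product)
  show "orientation (doubling G) (doubling_rev G) ori"
    using doubling_orientation by (simp add: doubling_orientation_def)
qed

context doubled_graph
begin

lemma arcs_doubling_iff: "a \<in> arcs (doubling G) \<longleftrightarrow> fst a \<in> parcs G"
  by (cases a) (simp add: doubling_def)

lemma tail_doubling: "tail (doubling G) a = fst (fst a)"
  by (simp add: doubling_def split_beta)

lemma parcs_swap: "(u, w) \<in> parcs G \<Longrightarrow> (w, u) \<in> parcs G"
  using pair_sym_arcs by (simp add: symmetric_def symD)

lemma First_in_ori_iff:
  assumes "(u, w) \<in> parcs G"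
  shows "((u, w), First) \<in> ori \<longleftrightarrow> ((w, u), Second) \<in> ori"
  using doubling_orientation assms by (auto simp: doubling_orientation_def)

text \<open>The first copy of an edge is oriented in exactly one direction; by
  \<open>First_in_ori_iff\<close> the second copy takes the other.\<close>

lemma First_in_ori_iff_swap:
  assumes "(u, w) \<in> parcs G"
  shows "((w, u), First) \<in> ori \<longleftrightarrow> ((u, w), First) \<notin> ori"
  using assms Dbl.rv_in_ori_iff[of "((u, w), First)"]
  by (simp add: arcs_doubling_iff doubling_rev_def swap_in_def)

lemma fst_ori: "a \<in> ori \<Longrightarrow> fst a \<in> parcs G"
  using Dbl.ori_subset arcs_doubling_iff by blast

text \<open>The inverse of \<open>fst\<close> restricted to \<open>ori\<close>: over each oriented
  edge of \<open>G\<close> exactly one of the two copies is oriented by \<open>ori\<close>.\<close>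

definition lift :: "'v \<times> 'v \<Rightarrow> ('v \<times> 'v) \<times> copy" where
  "lift e = (e, if (e, First) \<in> ori then First else Second)"

lemma fst_lift: "fst (lift e) = e"
  by (simp add: lift_def)

lemma inj_lift: "inj lift"
  by (rule inj_on_inverseI[of _ fst]) (simp add: fst_lift)

lemma map_fst_lift: "map fst (map lift C) = C"
  by (simp add: comp_def fst_lift)

lemma lift_in_ori:
  assumes "e \<in> parcs G"
  shows "lift e \<in> ori"
proof (cases e)
  case (Pair u w)
  then show ?thesis
    using assms First_in_ori_iff[OF parcs_swap[of u w]] First_in_ori_iff_swap[of u w]
    by (auto simp: lift_def)
qed

lemma lift_fst:
  assumes "a \<in> ori"
  shows "lift (fst a) = a"
proof -
  obtain u w i where a: "a = ((u, w), i)"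
    by (cases a) auto
  have "(u, w) \<in> parcs G"
    using fst_ori[OF assms] by (simp add: a)
  then show ?thesis
    using assms First_in_ori_iff[OF parcs_swap[of u w]] First_in_ori_iff_swap[of u w]
    by (cases i) (auto simp: a lift_def)
qed

text \<open>An arc of \<open>ori\<close> occurs in one summand only: a first copy in the one indexed
  by its own direction, a second copy in the one indexed by the reverse direction.\<close>

lemma lookup_task_lift:
  "Poly_Mapping.lookup (task_lift Q ori) a =
    (if a \<in> ori then int (Q (fst (fst a)) (snd (fst a))) else 0)"
proof -
  define S where "S = {e. (e, First) \<in> ori}"
  have "S \<subseteq> parcs G"
    using fst_ori by (auto simp: S_def)
  then have finS: "finite S"
    using pair_finite_arcs finite_subset by blast
  obtain u w i where a: "a = ((u, w), i)"
    by (cases a) auto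
  have lookup: "Poly_Mapping.lookup (task_lift Q ori) a = (\<Sum>(x, y) \<in> S.
      (if a = ((x, y), First) then int (Q x y) else 0) +
      (if a = ((y, x), Second) then int (Q y x) else 0))"
    unfolding task_lift_def lookup_sum S_def[symmetric]
    by (intro sum.cong) (auto simp: lookup_add)
  show ?thesis
  proof (cases i)
    case First
    have "Poly_Mapping.lookup (task_lift Q ori) a = (\<Sum>e \<in> S. if e = (u, w) then int (Q u w) else 0)"
      unfolding lookup by (intro sum.cong) (auto simp: a First split: if_splits)
    then show ?thesis
      using finS by (simp add: a First S_def)
  next
    case Second
    have "Poly_Mapping.lookup (task_lift Q ori) a = (\<Sum>e \<in> S. if e = (w, u) then int (Q u w) else 0)"
      unfolding lookup by (intro sum.cong) (auto simp: a Second split: if_splits)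
    \<comment> \<open>The index is the direction of the first copy, which is opposite to that of
      \<open>a\<close>.\<close>
    moreover have "(w, u) \<in> S \<longleftrightarrow> a \<in> ori"
      using fst_ori[of "((w, u), First)"] fst_ori[of "((u, w), Second)"]
        First_in_ori_iff[of w u] parcs_swap[of u w]
      by (auto simp: S_def a Second)
    ultimately show ?thesis
      using finS by (simp add: a)
  qed
qed

lemma task_lift_in_chains: "task_lift Q ori \<in> chains ori"
  by (simp add: in_chains_iff lookup_task_lift)

section \<open>Transfer of walks between the graph and its doubling\<close>

lemma awalk_map_fst_iff:
  "pre_digraph.awalk (with_proj G) u (map fst p) w \<longleftrightarrow> pre_digraph.awalk (doubling G) u p w"
proof -
  have "pre_digraph.cas (with_proj G) u (map fst p) w = pre_digraph.cas (doubling G) u p w"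
    by (induction p arbitrary: u) (auto simp: pre_digraph.cas.simps doubling_def split_beta
        simp del: cas_with_proj_eq)
  then show ?thesis
    by (auto simp: pre_digraph.awalk_def arcs_doubling_iff doubling_def simp del: cas_with_proj_eq)
qed

lemma closed_walk_at_map_fst_iff:
  "closed_walk_at (with_proj G) v (map fst p) \<longleftrightarrow> closed_walk_at (doubling G) v p"
  by (simp add: closed_walk_at_def awalk_map_fst_iff)

lemma walk_length_proj:
  "walk_length (swap_in (parcs G)) \<mu> (proj_walk p) =
    walk_length (doubling_rev G) (doubling_metric \<mu>) p"
  by (simp add: walk_length_def proj_walk_def comp_def doubling_metric_def doubling_rev_def)

text \<open>Lifting every step puts the walk inside \<open>ori\<close>; counts survive because
  \<open>lift\<close> is injective, and the length is unchanged. The chain \<alpha> is kept general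
  so that it may carry the extra edge of case (b).\<close>

lemma minimal_cycle_le_closed_walk:
  assumes min: "minimal_cycle_above (doubling G) (doubling_rev G) ori (doubling_metric \<mu>) \<alpha> \<beta>"
    and \<alpha>: "\<alpha> \<in> chains ori" "\<And>a. a \<in> ori \<Longrightarrow> 0 \<le> Poly_Mapping.lookup \<alpha> a"
    and C: "closed_walk_at (with_proj G) v C"
    and le: "\<And>e. e \<in> parcs G \<Longrightarrow> Poly_Mapping.lookup \<alpha> (lift e) \<le> int (count_list C e)"
  shows "chain_norm (doubling_rev G) ori (doubling_metric \<mu>) \<beta> \<le> walk_length (swap_in (parcs G)) \<mu> C"
proof -
  have walk: "Dbl.awalk v (map lift C) v"
    using C closed_walk_at_map_fst_iff[of v "map lift C"]
    by (simp add: map_fst_lift closed_walk_at_def del: map_map)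
  have "set C \<subseteq> parcs G"
    using C by (auto simp: closed_walk_at_def pre_digraph.awalk_def)
  then have "set (map lift C) \<subseteq> ori"
    using lift_in_ori by auto
  moreover have "Poly_Mapping.lookup \<alpha> a \<le> int (count_list (map lift C) a)" if "a \<in> ori" for a
    using le[OF fst_ori[OF that]] count_list_map_conv[OF inj_lift, of C "fst a"]
    by (simp add: lift_fst[OF that])
  ultimately have "chain_norm (doubling_rev G) ori (doubling_metric \<mu>) \<beta>
      \<le> walk_length (doubling_rev G) (doubling_metric \<mu>) (map lift C)"
    using Dbl.minimal_cycle_le_walk_length[OF min \<alpha> walk] by blast
  then show ?thesis
    using walk_length_proj[of \<mu> "map lift C"] by (simp add: proj_walk_def map_fst_lift del: map_map)
qed

text \<open>The lifted copy of an oriented edge alone is traversed often enough; the other copy can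
  only add to the count in the projection.\<close>

lemma feasible_proj_walk:
  assumes \<beta>: "\<beta> \<in> Lambda (doubling G) (doubling_rev G) ori \<alpha>"
    and Q: "\<And>a. a \<in> ori \<Longrightarrow> Poly_Mapping.lookup (task_lift Q ori) a \<le> Poly_Mapping.lookup \<alpha> a"
    and p: "closed_walk_at (doubling G) v p"
    and count: "\<And>a. a \<in> arcs (doubling G) \<Longrightarrow> count_list p a = nat (Dbl.deg \<beta> a)"
  shows "feasible_walk G Q v (proj_walk p)"
proof -
  have "Q u w \<le> count_list (map fst p) (u, w)" if "(u, w) \<in> parcs G" for u w
  \<comment> \<open>\<open>Lambda_deg_le\<close> speaks only of positive degrees, so an absent task
    is settled separately.\<close>
  proof (cases "Q u w = 0")
    case False
    define a where "a = lift (u, w)"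
    have a: "a \<in> ori" "fst a = (u, w)"
      using lift_in_ori[OF that] by (simp_all add: a_def fst_lift)
    then have "a \<in> arcs (doubling G)"
      using Dbl.ori_subset by auto
    have "int (Q u w) \<le> Dbl.deg \<alpha> a"
      using Q[OF a(1)] a by (simp add: lookup_task_lift Dbl.deg_ori)
    also have "\<dots> \<le> Dbl.deg \<beta> a"
      using calculation False \<open>a \<in> arcs (doubling G)\<close> by (intro Dbl.Lambda_deg_le[OF \<beta>]) auto
    finally have "Q u w \<le> count_list p a"
      using count[OF \<open>a \<in> arcs (doubling G)\<close>] by simp
    also have "\<dots> \<le> count_list (map fst p) (u, w)"
      using count_list_map_ge[of p a fst] a by simp
    finally show ?thesis .
  qed simp
  then show ?thesis
    using p closed_walk_at_map_fst_iff[of v p] by (auto simp: feasible_walk_def proj_walk_def)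
qed

text \<open>A closed walk whose counts are the positive degrees of \<beta> projects to a feasible
  walk of length the norm of \<beta>, which the assumed lower bound makes optimal. An Euler tour has
  these counts by construction.\<close>

lemma routing_of_minimal_cycle:
  assumes \<beta>: "\<beta> \<in> Lambda (doubling G) (doubling_rev G) ori \<alpha>"
      "\<beta> \<in> homology1 (doubling G) (doubling_rev G) ori"
    and con: "connected_chain (doubling G) (doubling_rev G) ori \<beta>"
    and v: "v \<in> verts (chain_support (doubling G) (doubling_rev G) ori \<beta>)"
    and Q: "\<And>a. a \<in> ori \<Longrightarrow> Poly_Mapping.lookup (task_lift Q ori) a \<le> Poly_Mapping.lookup \<alpha> a"
    and le: "\<And>C. feasible_walk G Q v C \<Longrightarrow>
      chain_norm (doubling_rev G) ori (doubling_metric \<mu>) \<beta> \<le> walk_length (swap_in (parcs G)) \<mu> C"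
  shows "\<exists>C. optimal_walk G \<mu> Q v C \<and>
      walk_length (swap_in (parcs G)) \<mu> C = chain_norm (doubling_rev G) ori (doubling_metric \<mu>) \<beta>"
    and "\<exists>p. circuit_at (doubling G) (doubling_rev G) v p \<and>
      abelianization (doubling_rev G) ori p = \<beta> \<and>
      real (length p) = chain_norm (doubling_rev G) ori (\<lambda>_. 1) \<beta>"
    and "\<lbrakk>circuit_at (doubling G) (doubling_rev G) v p; abelianization (doubling_rev G) ori p = \<beta>;
      real (length p) = chain_norm (doubling_rev G) ori (\<lambda>_. 1) \<beta>\<rbrakk> \<Longrightarrow>
      optimal_walk G \<mu> Q v (proj_walk p)"
proof -
  have arcs_of_walk: "set q \<subseteq> arcs (doubling G)" if "closed_walk_at (doubling G) v q" for q
    using that by (auto simp: closed_walk_at_def)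
  have norm: "walk_length (doubling_rev G) \<nu> q = chain_norm (doubling_rev G) ori \<nu> \<beta>"
    if "closed_walk_at (doubling G) v q"
      and "\<And>a. a \<in> arcs (doubling G) \<Longrightarrow> count_list q a = nat (Dbl.deg \<beta> a)" for q \<nu>
    using that(2) by (simp add: Dbl.walk_length_conv[OF arcs_of_walk[OF that(1)]] Dbl.chain_norm_conv)
  have opt: "optimal_walk G \<mu> Q v (proj_walk q)"
    if "closed_walk_at (doubling G) v q"
      and "\<And>a. a \<in> arcs (doubling G) \<Longrightarrow> count_list q a = nat (Dbl.deg \<beta> a)" for q
    unfolding optimal_walk_def is_arg_min_linorder
    using feasible_proj_walk[OF \<beta>(1) Q that] le norm[OF that] by (simp add: walk_length_proj)
  obtain q where q: "closed_walk_at (doubling G) v q"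
      "\<And>a. a \<in> arcs (doubling G) \<Longrightarrow> count_list q a = nat (Dbl.deg \<beta> a)"
    using Dbl.exists_closed_walk_of_cycle[OF \<beta>(2) con v] by blast
  show "\<exists>C. optimal_walk G \<mu> Q v C \<and>
      walk_length (swap_in (parcs G)) \<mu> C = chain_norm (doubling_rev G) ori (doubling_metric \<mu>) \<beta>"
    using opt[OF q] norm[OF q] walk_length_proj by metis
  have "\<beta> \<in> chains ori"
    using \<beta>(2) by (simp add: homology1_def)
  then have "abelianization (doubling_rev G) ori q = \<beta>"
    using Dbl.abelianization_eqI[OF arcs_of_walk[OF q(1)]] q(2) by blast
  moreover have "circuit_at (doubling G) (doubling_rev G) v q"
    using Dbl.circuit_atI q by blast
  moreover have "real (length q) = chain_norm (doubling_rev G) ori (\<lambda>_. 1) \<beta>"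
    using norm[OF q, of "\<lambda>_. 1"] by (simp add: Dbl.walk_length_one)
  ultimately show "\<exists>p. circuit_at (doubling G) (doubling_rev G) v p \<and>
      abelianization (doubling_rev G) ori p = \<beta> \<and>
      real (length p) = chain_norm (doubling_rev G) ori (\<lambda>_. 1) \<beta>"
    by blast
  assume p: "circuit_at (doubling G) (doubling_rev G) v p" "abelianization (doubling_rev G) ori p = \<beta>"
    "real (length p) = chain_norm (doubling_rev G) ori (\<lambda>_. 1) \<beta>"
  \<comment> \<open>For an arbitrary circuit the counts are forced by its length, through
    \<open>count_of_tight_walk\<close>.\<close>
  then have "closed_walk_at (doubling G) v p"
    by (simp add: circuit_at_def)
  then show "optimal_walk G \<mu> Q v (proj_walk p)"
    using opt Dbl.count_of_tight_walk[OF arcs_of_walk p(2,3)] by blast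
qed

end

theorem theorem5p5:
  fixes G :: "'v pair_pre_digraph"
    and \<mu> :: "('v \<times> 'v) set \<Rightarrow> real"
    and Q :: "'v \<Rightarrow> 'v \<Rightarrow> nat"
    and v :: 'v
    and \<alpha> \<beta> :: "(('v \<times> 'v) \<times> copy) \<Rightarrow>\<^sub>0 int"
  assumes "pair_graph G" and "Digraph_Component.connected (with_proj G)"
    and "metric (with_proj G) (swap_in (parcs G)) \<mu>"
    and "task_matrix G Q"
    and "v \<in> pverts G"
    and "Gh = doubling G" and "rh = doubling_rev G" and "\<mu>h = doubling_metric \<mu>"
    and "doubling_orientation G oh"
    and "\<alpha> = task_lift Q oh"
    and "v \<in> verts (chain_support Gh rh oh \<alpha>) \<Longrightarrow> minimal_cycle_above Gh rh oh \<mu>h \<alpha> \<beta>"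
    and "v \<notin> verts (chain_support Gh rh oh \<alpha>) \<Longrightarrow>
       \<exists>B. (\<forall>a \<in> oh \<inter> out_arcs Gh v. minimal_cycle_above Gh rh oh \<mu>h (\<alpha> + frag_of a) (B a)) \<and>
           (\<exists>a \<in> oh \<inter> out_arcs Gh v. \<beta> = B a) \<and>
           chain_norm rh oh \<mu>h \<beta> = (MIN a \<in> oh \<inter> out_arcs Gh v. chain_norm rh oh \<mu>h (B a))"
    and "connected_chain Gh rh oh \<beta>"
  shows "(\<exists>C. optimal_walk G \<mu> Q v C \<and>
              walk_length (swap_in (parcs G)) \<mu> C = chain_norm rh oh \<mu>h \<beta>) \<and>
         (\<exists>Ch. circuit_at Gh rh v Ch \<and> abelianization rh oh Ch = \<beta> \<and>
               real (length Ch) = chain_norm rh oh (\<lambda>_. 1) \<beta>) \<and>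
         (\<forall>Ch. circuit_at Gh rh v Ch \<and> abelianization rh oh Ch = \<beta> \<and>
               real (length Ch) = chain_norm rh oh (\<lambda>_. 1) \<beta> \<longrightarrow>
               optimal_walk G \<mu> Q v (proj_walk Ch))"
proof -
  interpret doubled_graph G oh
    using assms(1,9) by (simp add: doubled_graph_def doubled_graph_axioms_def)
  note [simp] = \<open>Gh = doubling G\<close> \<open>rh = doubling_rev G\<close> \<open>\<mu>h = doubling_metric \<mu>\<close>
  have \<alpha>: "\<alpha> \<in> chains oh" "0 \<le> Poly_Mapping.lookup \<alpha> a" for a
    by (simp_all add: \<open>\<alpha> = task_lift Q oh\<close> task_lift_in_chains lookup_task_lift)
  have feasible_le: "Poly_Mapping.lookup \<alpha> (lift e) \<le> int (count_list C e)"
    if "feasible_walk G Q v C" "e \<in> parcs G" for C e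
    using that by (auto simp: \<open>\<alpha> = task_lift Q oh\<close> lookup_task_lift fst_lift feasible_walk_def)
  have verts_mono: "verts (chain_support Gh rh oh \<alpha>') \<subseteq> verts (chain_support Gh rh oh \<beta>)"
    if "\<beta> \<in> Lambda Gh rh oh \<alpha>'" for \<alpha>'
    using Dbl.Lambda_mono_orientation[of \<beta> \<alpha>'] that
    by (auto simp: chain_support_def support_def)
  \<comment> \<open>Both cases in one form: \<alpha>' is \<alpha> in case (a) and \<alpha> plus the
    chosen edge at \<open>v\<close> in case (b).\<close>
  have "\<exists>\<alpha>'. \<beta> \<in> Lambda Gh rh oh \<alpha>' \<and> \<beta> \<in> homology1 Gh rh oh \<and>
      v \<in> verts (chain_support Gh rh oh \<alpha>') \<and>
      (\<forall>a. Poly_Mapping.lookup \<alpha> a \<le> Poly_Mapping.lookup \<alpha>' a) \<and>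
      (\<forall>C. feasible_walk G Q v C \<longrightarrow>
        chain_norm rh oh \<mu>h \<beta> \<le> walk_length (swap_in (parcs G)) \<mu> C)"
  proof (cases "v \<in> verts (chain_support Gh rh oh \<alpha>)")
    case True
    then have min: "minimal_cycle_above Gh rh oh \<mu>h \<alpha> \<beta>"
      by (rule assms(11))
    moreover have "chain_norm rh oh \<mu>h \<beta> \<le> walk_length (swap_in (parcs G)) \<mu> C"
      if "feasible_walk G Q v C" for C
      using minimal_cycle_le_closed_walk[of \<mu> \<alpha> \<beta> v C] min \<alpha> feasible_le[OF that] that
      by (simp add: feasible_walk_def)
    ultimately show ?thesis
      using True by (auto simp: minimal_cycle_above_def is_arg_min_def)
  next
    case False
    then obtain B a0 where B: "\<And>a. a \<in> oh \<inter> out_arcs Gh v \<Longrightarrow>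
          minimal_cycle_above Gh rh oh \<mu>h (\<alpha> + frag_of a) (B a)"
      and a0: "a0 \<in> oh \<inter> out_arcs Gh v" "\<beta> = B a0"
      and norm: "chain_norm rh oh \<mu>h \<beta> = (MIN a \<in> oh \<inter> out_arcs Gh v. chain_norm rh oh \<mu>h (B a))"
      using assms(12) by blast
    have "chain_norm rh oh \<mu>h \<beta> \<le> walk_length (swap_in (parcs G)) \<mu> C"
      if C: "feasible_walk G Q v C" for C
    proof -
      \<comment> \<open>A closed walk is nonempty, and the lift of its first edge is one of the
        candidate edges leaving \<open>v\<close>.\<close>
      obtain e C' where C': "C = e # C'" and e: "e \<in> parcs G" "fst e = v"
        using C by (cases C) (auto simp: feasible_walk_def closed_walk_at_def pre_digraph.awalk_def
            pre_digraph.cas.simps simp del: cas_with_proj_eq)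
      define a where "a = lift e"
      have a: "a \<in> oh \<inter> out_arcs Gh v"
        using lift_in_ori[OF e(1)] e Dbl.ori_subset by (auto simp: a_def tail_doubling fst_lift)
      \<comment> \<open>No task touches \<open>v\<close>, so the raised requirement at
        \<open>a\<close> is exactly 1, which the first step of \<open>C\<close> meets.\<close>
      have "Poly_Mapping.lookup \<alpha> a = 0"
      proof (rule ccontr)
        assume "Poly_Mapping.lookup \<alpha> a \<noteq> 0"
        then have "a \<in> chain_orientation Gh rh oh \<alpha>"
          using a \<alpha>(2)[of a] by (auto simp: chain_orientation_def Dbl.deg_ori)
        then show False
          using False a by (auto simp: chain_support_def support_def)
      qed
      then have le: "Poly_Mapping.lookup (\<alpha> + frag_of a) (lift x) \<le> int (count_list C x)"
        if "x \<in> parcs G" for x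
        using feasible_le[OF C that] inj_lift C'
        by (cases "x = e") (auto simp: lookup_add a_def inj_eq)
      have "chain_norm rh oh \<mu>h \<beta> \<le> chain_norm rh oh \<mu>h (B a)"
        unfolding norm using a Dbl.finite_ori by (intro Min_le) auto
      also have "\<dots> \<le> walk_length (swap_in (parcs G)) \<mu> C"
        using minimal_cycle_le_closed_walk[of \<mu> "\<alpha> + frag_of a" "B a" v C] B[OF a] \<alpha> a le C
        by (simp add: feasible_walk_def in_chains_iff lookup_add)
      finally show ?thesis .
    qed
    \<comment> \<open>The added edge has a positive coefficient, which brings its tail
      \<open>v\<close> into the support.\<close>
    moreover have "a0 \<in> chain_orientation Gh rh oh (\<alpha> + frag_of a0)"
      using a0 \<alpha>(2)[of a0] by (auto simp: chain_orientation_def Dbl.deg_ori lookup_add)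
    then have "v \<in> verts (chain_support Gh rh oh (\<alpha> + frag_of a0))"
      using a0 by (auto simp: chain_support_def support_def)
    moreover have "\<forall>a. Poly_Mapping.lookup \<alpha> a \<le> Poly_Mapping.lookup (\<alpha> + frag_of a0) a"
      by (simp add: lookup_add)
    ultimately show ?thesis
      using B[OF a0(1)] a0(2) by (auto simp: minimal_cycle_above_def is_arg_min_def)
  qed
  then obtain \<alpha>' where \<alpha>': "\<beta> \<in> Lambda Gh rh oh \<alpha>'" "\<beta> \<in> homology1 Gh rh oh"
      "v \<in> verts (chain_support Gh rh oh \<alpha>')"
      "\<And>a. Poly_Mapping.lookup \<alpha> a \<le> Poly_Mapping.lookup \<alpha>' a"
      "\<And>C. feasible_walk G Q v C \<Longrightarrow>
        chain_norm rh oh \<mu>h \<beta> \<le> walk_length (swap_in (parcs G)) \<mu> C"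
    by blast
  have v: "v \<in> verts (chain_support Gh rh oh \<beta>)"
    using verts_mono[OF \<alpha>'(1)] \<alpha>'(3) by blast
  note routing = routing_of_minimal_cycle[of \<beta> \<alpha>' v Q \<mu>,
    folded \<open>Gh = doubling G\<close> \<open>rh = doubling_rev G\<close> \<open>\<mu>h = doubling_metric \<mu>\<close> \<open>\<alpha> = task_lift Q oh\<close>,
    OF \<alpha>'(1,2) assms(13) v \<alpha>'(4,5)]
  show ?thesis
    using routing by blast
qed

end
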